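(* Let $\mathbb{K}$ be a field of characteristic $0$ and let $\mathbb{F}$ be $\mathbb{K}[x]$ or $\mathbb{K}(x)$ with derivation $\partial/\partial x$. Let $p\in\mathbb{F}[y^{(\infty)}]$ and $q\in\mathbb{F}[z^{(\infty)}]$ be differential polynomials of order $n$ and $m$, respectively. If $p$ and $q$ are both linear in their highest order terms (l.h.o.), then $$\mathfrak{o}_{\circ}(p,q)\;\le\; m+n,$$ where $\mathfrak{o}_\circ(p,q)$ is the minimal order of a non-zero differential polynomial in $w$ that can be derived from the dynamical model $\mathcal{M}_{\circ(p,q)}$ encoding the composition $w=y\circ z$ (defined in the context). In particular, such a non-zero differential polynomial exists.
   Context: Differential polynomials: $\mathbb{F}[y^{(\infty)}]=\mathbb{F}[y,y',y'',\ldots]$ is the polynomial ring in infinitely many variables $y^{(j)}$ ($j\in\mathbb{N}$, $y^{(0)}=y$) with the derivation extending that of $\mathbb{F}$ and satisfying $(y^{(j)})'=y^{(j+1)}$; similarly for several differential indeterminates. The order of a non-zero differential polynomial is the largest $n$ such that $y^{(n)}$ occurs in it. A differential polynomial $p$ of order $n$ is linear in its highest order term (l.h.o.) if $y^{(n)}$ appears only linearly in $p$, i.e. $p$ has degree $1$ in $y^{(n)}$. If $q$ is l.h.o. of order $m$, then $q=0$ can be solved for $z^{(m)}$, giving $z^{(m)}=r_q(x,z,\ldots,z^{(m-1)})$ with $r_q$ a rational function over $\mathbb{K}$. For a set $S$ of differential polynomials, $\langle S\rangle^{(\infty)}$ is the ideal generated by all elements of $S$ and all their derivatives. For an ideal $I$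 of a ring $R$ and $s\in R$, $I:s^\infty=\{r\in R\mid \exists k\in\mathbb{N}: s^k r\in I\}$. Dynamical model: a system $\mathcal{M}$ of the form $u_i'=A_i(u_1,\ldots,u_N)$ $(1\le i\le N)$, $w=B(u_1,\ldots,u_N)$, with $A_i,B\in\mathbb{K}(x)(u_1,\ldots,u_N)$. Its dimension is $N$. Let $Q$ be the common denominator of the system and write $A_i=a_i/Q$, $B=b/Q$ with $a_i,b,Q\in\mathbb{K}(x)[u_1,\ldots,u_N]$. Put $$I_{\mathcal{M}}=\langle Qu_1'-a_1,\ldots,Qu_N'-a_N,\;Qw-b\rangle^{(\infty)}:Q^\infty\;\subset\;\mathbb{K}(x)[u_1^{(\infty)},\ldots,u_N^{(\infty)},w^{(\infty)}].$$ The differential polynomials in $w$ derived from $\mathcal{M}$ are the elements of $I_{\mathcal{M}}\cap\mathbb{K}(x)[w^{(\infty)}]$. The model $\mathcal{M}_{\circ(p,q)}$: define $S_j$ recursively by $S_0=y$ and, if $S_j=\sum_{i=0}^j c_i y^{(i)}$ with $c_i\in\mathbb{K}[z^{(\infty)}]$, then $S_{j+1}=\sum_{i=0}^j\bigl(c_i'\,y^{(i)}+c_i\,z'\,y^{(i+1)}\bigr)$ (here $y^{(i)}$ stands for $f^{(i)}\circ g$ and $z$ for $g$, so that $S_j$ stands for $(f\circ g)^{(j)}$). Solving the triangular system $w^{(j)}=S_j$, $0\le j\le n$, for $y,\ldots,y^{(n)}$ gives $y^{(k)}=a_k$ with $a_k\in\mathbb{K}(w,\ldots,w^{(k)},z,\ldots,z^{(k)})$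 (with only powers of $z'$ in the denominators). In $p$, replace $x$ by $z$ and each $y^{(k)}$ by $a_k$. This gives a rational expression $R$ in $z,\ldots,z^{(n)},w,\ldots,w^{(n)}$ in which $w^{(n)}$ appears linearly when $p$ is l.h.o. Solve $R=0$ for $w^{(n)}$ to get $w^{(n)}=r_p(z,\ldots,z^{(n)},w,\ldots,w^{(n-1)})$. If $m\le n$, all $z^{(j)}$ with $m\le j\le n$ are moreover rewritten in terms of $x,z,\ldots,z^{(m-1)}$ using $z^{(m)}=r_q(x,z,\ldots,z^{(m-1)})$ and its derivatives. With $u_1=z,\ldots,u_m=z^{(m-1)}$, $u_{m+1}=w,\ldots,u_{m+n}=w^{(n-1)}$, the function $r_p$ then depends only on $x,u_1,\ldots,u_{m+n}$, and $\mathcal{M}_{\circ(p,q)}$ is the system $$u_i'=u_{i+1}\ (1\le i\le m-1),\quad u_m'=r_q(x,u_1,\ldots,u_m),$$ $$u_{m+i}'=u_{m+i+1}\ (1\le i\le n-1),\quad u_{m+n}'=r_p(x,u_1,\ldots,u_{m+n}),$$ $$w=u_{m+1}.$$ (If $m=0$ there are no state variables for $z$, and $z=r_q(x)$; if $n=0$ there are no state variables for $w$, and the last equation is $w=r_p$. The construction presupposes that the denominators occurring, which are powers of $z'$, do not become $0$ after rewriting with $r_q$.) Finally, $\mathfrak{o}_\circ(p,q)$ is the minimal order of a non-zero element of $I_{\mathcal{M}_{\circ(p,q)}}\cap\mathbb{K}(x)[w^{(\infty)}]$. *)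

theory Defs
  imports "HOL-Library.Poly_Mapping" "HOL-Computational_Algebra.Polynomial_Factorial"
begin

section \<open>Multivariate polynomials and rational functions\<close>

type_synonym ('v, 'a) mpoly = "('v \<Rightarrow>\<^sub>0 nat) \<Rightarrow>\<^sub>0 'a"

definition mconst :: "'a \<Rightarrow> ('v, 'a::zero) mpoly" where
  "mconst c = Poly_Mapping.single 0 c"

definition mvar :: "'v \<Rightarrow> ('v, 'a::zero_neq_one) mpoly" where
  "mvar v = Poly_Mapping.single (Poly_Mapping.single v 1) 1"

definition vars :: "('v, 'a::zero) mpoly \<Rightarrow> 'v set" where
  "vars P = (\<Union>t\<in>Poly_Mapping.keys P. Poly_Mapping.keys t)"

definition degree_in :: "'v \<Rightarrow> ('v, 'a::zero) mpoly \<Rightarrow> nat" where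
  "degree_in v P = Max (insert 0 ((\<lambda>t. Poly_Mapping.lookup t v) ` Poly_Mapping.keys P))"

definition mpoly_eval ::
    "('a::zero \<Rightarrow> 'b::comm_semiring_1) \<Rightarrow> ('v \<Rightarrow> 'b) \<Rightarrow> ('v, 'a) mpoly \<Rightarrow> 'b" where
  "mpoly_eval \<kappa> \<sigma> P = (\<Sum>t\<in>Poly_Mapping.keys P.
     \<kappa> (Poly_Mapping.lookup P t) * (\<Prod>v\<in>Poly_Mapping.keys t. \<sigma> v ^ Poly_Mapping.lookup t v))"

definition pdiff :: "'v \<Rightarrow> ('v, 'a::comm_semiring_1) mpoly \<Rightarrow> ('v, 'a) mpoly" where
  "pdiff v P = (\<Sum>t\<in>Poly_Mapping.keys P.
     Poly_Mapping.single (t - Poly_Mapping.single v 1)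
       (of_nat (Poly_Mapping.lookup t v) * Poly_Mapping.lookup P t))"

text \<open>The extension to the fraction field of a map on the ring: for a homomorphism \<open>h\<close>, it is
  defined at those fractions having a representation whose denominator is not sent to \<open>0\<close>.\<close>

definition fract_eval_defined :: "('a::idom \<Rightarrow> 'b::field) \<Rightarrow> 'a fract \<Rightarrow> bool" where
  "fract_eval_defined h f \<longleftrightarrow> (\<exists>a b. f = Fract a b \<and> b \<noteq> 0 \<and> h b \<noteq> 0)"

definition fract_eval :: "('a::idom \<Rightarrow> 'b::field) \<Rightarrow> 'a fract \<Rightarrow> 'b" where
  "fract_eval h f = (THE r. \<exists>a b. f = Fract a b \<and> b \<noteq> 0 \<and> h b \<noteq> 0 \<and> r = h a / h b)"

lemma fract_eval_Fract:
  assumes "\<And>x y. h (x * y) = h x * h y" and "b \<noteq> 0" and "h b \<noteq> 0"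
  shows "fract_eval h (Fract a b) = h a / h b"
  unfolding fract_eval_def
proof (rule the_equality)
  fix r
  assume "\<exists>c d. Fract a b = Fract c d \<and> d \<noteq> 0 \<and> h d \<noteq> 0 \<and> r = h c / h d"
  then obtain c d where cd: "Fract a b = Fract c d" "d \<noteq> 0" "h d \<noteq> 0" "r = h c / h d"
    by blast
  then have "a * d = c * b"
    using assms(2) by (simp add: eq_fract)
  then have "h a * h d = h c * h b"
    by (metis assms(1))
  then show "r = h a / h b"
    using cd(3,4) assms(3) by (simp add: frac_eq_eq)
qed (use assms in blast)

text \<open>The extension of a derivation to the fraction field by the quotient rule.\<close>

definition quot_ext :: "('a::idom \<Rightarrow> 'a) \<Rightarrow> 'a fract \<Rightarrow> 'a fract" where
  "quot_ext d f = (THE r. \<exists>a b. f = Fract a b \<and> b \<noteq> 0 \<and> r = Fract (d a * b - a * d b) (b\<^sup>2))"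

lemma quot_ext_Fract:
  assumes leib: "\<And>x y. d (x * y) = d x * y + x * d y" and "b \<noteq> 0"
  shows "quot_ext d (Fract a b) = Fract (d a * b - a * d b) (b\<^sup>2)"
  unfolding quot_ext_def
proof (rule the_equality)
  fix r
  assume "\<exists>x y. Fract a b = Fract x y \<and> y \<noteq> 0 \<and> r = Fract (d x * y - x * d y) (y\<^sup>2)"
  then obtain x y where xy: "Fract a b = Fract x y" "y \<noteq> 0" "r = Fract (d x * y - x * d y) (y\<^sup>2)"
    by blast
  then have e: "a * y = x * b"
    using assms(2) by (simp add: eq_fract)
  then have de: "d a * y + a * d y = d x * b + x * d b"
    by (metis leib)
  have "(d x * y - x * d y) * b\<^sup>2 = (d a * b - a * d b) * y\<^sup>2"
    using e de by algebra
  then show "r = Fract (d a * b - a * d b) (b\<^sup>2)"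
    using xy assms(2) by (simp add: eq_fract)
qed (use assms in blast)

definition rat_funs :: "'v::linorder set \<Rightarrow> ('v, 'a::idom) mpoly fract set" where
  "rat_funs V = {Fract a b | a b. b \<noteq> 0 \<and> vars a \<subseteq> V \<and> vars b \<subseteq> V}"

text \<open>The solution for \<open>v\<close> of \<open>f = 0\<close>, where \<open>f = A v + B\<close> is linear in \<open>v\<close>.\<close>

definition solve_for :: "'v::linorder \<Rightarrow> ('v, 'a::idom) mpoly fract \<Rightarrow> ('v, 'a) mpoly fract" where
  "solve_for v f = (THE r. \<exists>A\<in>rat_funs (- {v}). \<exists>B\<in>rat_funs (- {v}).
     A \<noteq> 0 \<and> f = A * to_fract (mvar v) + B \<and> r = - (B / A))"


lemma lookup_mult_mvar:
  fixes a :: "('v, 'a::comm_ring_1) mpoly"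
  shows "Poly_Mapping.lookup (a * mvar v) (t + Poly_Mapping.single v 1) = Poly_Mapping.lookup a t"
proof -
  have "a = (\<Sum>s\<in>Poly_Mapping.keys a. Poly_Mapping.single s (Poly_Mapping.lookup a s))"
    by (rule poly_mapping_eqI)
      (simp add: lookup_sum lookup_single when_def in_keys_iff)
  then have "a * mvar v =
      (\<Sum>s\<in>Poly_Mapping.keys a. Poly_Mapping.single s (Poly_Mapping.lookup a s)) * mvar v"
    by (rule arg_cong)
  also have "\<dots> = (\<Sum>s\<in>Poly_Mapping.keys a.
      Poly_Mapping.single (s + Poly_Mapping.single v 1) (Poly_Mapping.lookup a s))"
    by (simp add: mvar_def sum_distrib_right mult_single)
  finally have "a * mvar v = (\<Sum>s\<in>Poly_Mapping.keys a.
      Poly_Mapping.single (s + Poly_Mapping.single v 1) (Poly_Mapping.lookup a s))" .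
  then show ?thesis
    by (simp add: lookup_sum lookup_single when_def in_keys_iff)
qed

lemma vars_mult: "vars (a * b :: ('v, 'a::comm_ring_1) mpoly) \<subseteq> vars a \<union> vars b"
proof
  fix v
  assume "v \<in> vars (a * b)"
  then obtain t where t: "t \<in> Poly_Mapping.keys (a * b)" "v \<in> Poly_Mapping.keys t"
    by (auto simp: vars_def)
  then obtain r s where "t = r + s" "r \<in> Poly_Mapping.keys a" "s \<in> Poly_Mapping.keys b"
    using keys_mult by blast
  with t(2) show "v \<in> vars a \<union> vars b"
    using keys_add[of r s] by (auto simp: vars_def)
qed

lemma vars_diff: "vars (a - b :: ('v, 'a::comm_ring_1) mpoly) \<subseteq> vars a \<union> vars b"
  using Poly_Mapping.keys_diff[of a b] by (auto simp: vars_def)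

lemma rat_funs_diff:
  assumes "f \<in> rat_funs V" "g \<in> rat_funs V"
  shows "f - g \<in> rat_funs V"
proof -
  from assms obtain a b c d where *: "f = Fract a b" "g = Fract c d" "b \<noteq> 0" "d \<noteq> 0"
    "vars a \<subseteq> V" "vars b \<subseteq> V" "vars c \<subseteq> V" "vars d \<subseteq> V"
    unfolding rat_funs_def by blast
  then have "f - g = Fract (a * d - c * b) (b * d)" "b * d \<noteq> 0"
    by simp_all
  moreover have "vars (a * d - c * b) \<subseteq> V" "vars (b * d) \<subseteq> V"
    using *(5-8) by (auto dest!: subsetD[OF vars_diff] subsetD[OF vars_mult])
  ultimately show ?thesis
    unfolding rat_funs_def by blast
qed

lemma linear_eq_0D:
  fixes C D :: "('v::linorder, 'a::idom) mpoly fract"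
  assumes C: "C \<in> rat_funs (- {v})" and D: "D \<in> rat_funs (- {v})"
    and eq: "C * to_fract (mvar v) + D = 0"
  shows "C = 0"
proof -
  from C D obtain a b c d where *: "C = Fract a b" "D = Fract c d" "b \<noteq> 0" "d \<noteq> 0"
    "v \<notin> vars a" "v \<notin> vars b" "v \<notin> vars c" "v \<notin> vars d"
    unfolding rat_funs_def by blast
  from eq *(1-4) have "(a * d) * mvar v + c * b = 0"
    by (simp add: to_fract_def Zero_fract_def eq_fract algebra_simps)
  moreover have "v \<notin> vars (a * d)" "v \<notin> vars (c * b)"
    using *(5-8) by (auto dest!: subsetD[OF vars_mult])
  moreover have "p = 0" if "p * mvar v + e = 0" "v \<notin> vars p" "v \<notin> vars e"
    for p e :: "('v, 'a) mpoly"
  proof (rule poly_mapping_eqI)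
    fix t :: "'v \<Rightarrow>\<^sub>0 nat"
    have "v \<in> Poly_Mapping.keys (t + Poly_Mapping.single v 1)"
      by (simp add: in_keys_iff lookup_add)
    then have "t + Poly_Mapping.single v 1 \<notin> Poly_Mapping.keys e"
      using that(3) unfolding vars_def by blast
    then have "Poly_Mapping.lookup e (t + Poly_Mapping.single v 1) = 0"
      unfolding in_keys_iff by simp
    then have "Poly_Mapping.lookup (p * mvar v) (t + Poly_Mapping.single v 1) = 0"
      using arg_cong[OF that(1), of "\<lambda>f. Poly_Mapping.lookup f (t + Poly_Mapping.single v 1)"]
      unfolding lookup_add lookup_zero by simp
    then show "Poly_Mapping.lookup p t = Poly_Mapping.lookup 0 t"
      unfolding lookup_mult_mvar by simp
  qed
  ultimately have "a * d = 0"
    by blast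
  then show ?thesis
    using * by (simp add: Zero_fract_def eq_fract)
qed

lemma solve_for_eq:
  assumes A: "A \<in> rat_funs (- {v})" "A \<noteq> 0" and B: "B \<in> rat_funs (- {v})"
  shows "solve_for v (A * to_fract (mvar v) + B) = - (B / A)"
  unfolding solve_for_def
proof (rule the_equality)
  fix r
  assume "\<exists>A'\<in>rat_funs (- {v}). \<exists>B'\<in>rat_funs (- {v}). A' \<noteq> 0 \<and>
    A * to_fract (mvar v) + B = A' * to_fract (mvar v) + B' \<and> r = - (B' / A')"
  then obtain A' B' where *: "A' \<in> rat_funs (- {v})" "B' \<in> rat_funs (- {v})"
    "A * to_fract (mvar v) + B = A' * to_fract (mvar v) + B'" "r = - (B' / A')"
    by blast
  have "(A - A') * to_fract (mvar v) + (B - B') = 0"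
    using *(3) by (simp add: algebra_simps)
  then have "A = A'"
    using linear_eq_0D[OF rat_funs_diff[OF A(1) *(1)] rat_funs_diff[OF B *(2)]] by simp
  moreover from this have "B = B'"
    using *(3) by simp
  ultimately show "r = - (B / A)"
    using *(4) by (simp only:)
qed (intro bexI[OF _ A(1)] bexI[OF _ B] conjI A(2) refl)


section \<open>Differential polynomials\<close>

definition dx :: "'k::field poly fract \<Rightarrow> 'k poly fract" where
  "dx = quot_ext pderiv"

text \<open>The derivation on polynomials extending the derivation \<open>\<delta>\<close> of the coefficients and sending
  every variable \<open>v\<close> to the variable \<open>s v\<close>.\<close>

definition dpoly_deriv ::
    "('a \<Rightarrow> 'a) \<Rightarrow> ('v \<Rightarrow> 'v) \<Rightarrow> ('v, 'a::comm_ring_1) mpoly \<Rightarrow> ('v, 'a) mpoly" where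
  "dpoly_deriv \<delta> s P = Poly_Mapping.map \<delta> P + (\<Sum>v\<in>vars P. pdiff v P * mvar (s v))"

text \<open>Here \<open>y j\<close> is the variable that stands for the \<open>j\<close>-th derivative of an indeterminate.\<close>

definition has_order :: "(nat \<Rightarrow> 'v) \<Rightarrow> ('v, 'a::zero) mpoly \<Rightarrow> nat \<Rightarrow> bool" where
  "has_order y P n \<longleftrightarrow> y n \<in> vars P \<and> (\<forall>j. y j \<in> vars P \<longrightarrow> j \<le> n)"

text \<open>In the differential polynomials in a single indeterminate, the \<open>j\<close>-th derivative of that
  indeterminate is the variable \<open>j\<close>.\<close>

type_synonym 'a dpoly1 = "(nat, 'a) mpoly"

definition lho :: "'a::zero dpoly1 \<Rightarrow> nat \<Rightarrow> bool" where
  "lho P n \<longleftrightarrow> has_order id P n \<and> degree_in n P = 1"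

definition dpolys_over :: "'a::zero set \<Rightarrow> 'a dpoly1 set" where
  "dpolys_over F = {P. \<forall>t. Poly_Mapping.lookup P t \<in> F}"


section \<open>Dynamical models\<close>

text \<open>Elements of \<open>\<bbbK>(x)(u\<^sub>1, u\<^sub>2, \<dots>)\<close>; the variable \<open>i\<close> stands for \<open>u\<^sub>i\<close>.\<close>

type_synonym 'k ufun = "(nat, 'k poly fract) mpoly fract"

text \<open>Only \<open>rhs M i\<close> for \<open>1 \<le> i \<le> dim M\<close> is meaningful.\<close>

record (overloaded) 'k model =
  dim :: nat
  rhs :: "nat \<Rightarrow> 'k ufun"
  out :: "'k ufun"

definition common_denominator ::
    "'k::field model \<Rightarrow> (nat, 'k poly fract) mpoly \<Rightarrow> (nat \<Rightarrow> (nat, 'k poly fract) mpoly)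
      \<Rightarrow> (nat, 'k poly fract) mpoly \<Rightarrow> bool" where
  "common_denominator M Q a b \<longleftrightarrow>
     Q \<noteq> 0 \<and> vars Q \<subseteq> {1..dim M} \<and>
     (\<forall>i\<in>{1..dim M}. vars (a i) \<subseteq> {1..dim M} \<and> rhs M i = Fract (a i) Q) \<and>
     vars b \<subseteq> {1..dim M} \<and> out M = Fract b Q"

text \<open>\<open>Ud i j\<close> and \<open>Od j\<close> stand for the \<open>j\<close>-th derivatives of \<open>u\<^sub>i\<close> and of the output \<open>w\<close>.\<close>

datatype sysvar = Ud nat nat | Od nat

fun next_sysvar :: "sysvar \<Rightarrow> sysvar" where
  "next_sysvar (Ud i j) = Ud i (Suc j)"
| "next_sysvar (Od j) = Od (Suc j)"

type_synonym 'k sys_dpoly = "(sysvar, 'k poly fract) mpoly"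

definition sys_deriv :: "'k::field sys_dpoly \<Rightarrow> 'k sys_dpoly" where
  "sys_deriv = dpoly_deriv dx next_sysvar"

definition sys_of_u :: "(nat, 'k::field poly fract) mpoly \<Rightarrow> 'k sys_dpoly" where
  "sys_of_u = mpoly_eval mconst (\<lambda>i. mvar (Ud i 0))"

definition sys_ring :: "nat \<Rightarrow> 'k::field sys_dpoly set" where
  "sys_ring N = {P. vars P \<subseteq> {Ud i j | i j. 1 \<le> i \<and> i \<le> N} \<union> range Od}"

definition ideal_generated :: "'a::comm_ring_1 set \<Rightarrow> 'a set \<Rightarrow> 'a set" where
  "ideal_generated R S = {\<Sum>s\<in>T. c s * s | T c. finite T \<and> T \<subseteq> S \<and> (\<forall>s\<in>T. c s \<in> R)}"

definition saturation :: "'a::comm_ring_1 set \<Rightarrow> 'a set \<Rightarrow> 'a \<Rightarrow> 'a set" where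
  "saturation R I s = {r\<in>R. \<exists>k::nat. s ^ k * r \<in> I}"

definition sys_gens ::
    "nat \<Rightarrow> (nat, 'k::field poly fract) mpoly \<Rightarrow> (nat \<Rightarrow> (nat, 'k poly fract) mpoly)
      \<Rightarrow> (nat, 'k poly fract) mpoly \<Rightarrow> 'k sys_dpoly set" where
  "sys_gens N Q a b =
     {sys_of_u Q * mvar (Ud i 1) - sys_of_u (a i) | i. 1 \<le> i \<and> i \<le> N}
     \<union> {sys_of_u Q * mvar (Od 0) - sys_of_u b}"

definition model_ideal ::
    "nat \<Rightarrow> (nat, 'k::field poly fract) mpoly \<Rightarrow> (nat \<Rightarrow> (nat, 'k poly fract) mpoly)
      \<Rightarrow> (nat, 'k poly fract) mpoly \<Rightarrow> 'k sys_dpoly set" where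
  "model_ideal N Q a b =
     saturation (sys_ring N)
       (ideal_generated (sys_ring N) {(sys_deriv ^^ k) g | k g. g \<in> sys_gens N Q a b})
       (sys_of_u Q)"

definition derived_dpolys ::
    "nat \<Rightarrow> (nat, 'k::field poly fract) mpoly \<Rightarrow> (nat \<Rightarrow> (nat, 'k poly fract) mpoly)
      \<Rightarrow> (nat, 'k poly fract) mpoly \<Rightarrow> 'k sys_dpoly set" where
  "derived_dpolys N Q a b = model_ideal N Q a b \<inter> {P. vars P \<subseteq> range Od}"

definition derived_orders ::
    "nat \<Rightarrow> (nat, 'k::field poly fract) mpoly \<Rightarrow> (nat \<Rightarrow> (nat, 'k poly fract) mpoly)
      \<Rightarrow> (nat, 'k poly fract) mpoly \<Rightarrow> nat set" where
  "derived_orders N Q a b = {r. \<exists>P\<in>derived_dpolys N Q a b. P \<noteq> 0 \<and> has_order Od P r}"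

text \<open>This is meaningful only if \<open>derived_orders N Q a b\<close> is not empty.\<close>

definition min_derived_order ::
    "nat \<Rightarrow> (nat, 'k::field poly fract) mpoly \<Rightarrow> (nat \<Rightarrow> (nat, 'k poly fract) mpoly)
      \<Rightarrow> (nat, 'k poly fract) mpoly \<Rightarrow> nat" where
  "min_derived_order N Q a b = (LEAST r. r \<in> derived_orders N Q a b)"


section \<open>The model of a composition\<close>

text \<open>\<open>Zd j\<close> and \<open>Wd j\<close> stand for the \<open>j\<close>-th derivatives of \<open>z\<close> and \<open>w\<close>. The order only serves
  to make the polynomial ring an instance of class \<open>idom\<close>.\<close>

datatype zwvar = Zd nat | Wd nat

instantiation zwvar :: linorder
begin

fun zwvar_code :: "zwvar \<Rightarrow> nat" where
  "zwvar_code (Zd j) = 2 * j"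
| "zwvar_code (Wd j) = 2 * j + 1"

definition less_eq_zwvar :: "zwvar \<Rightarrow> zwvar \<Rightarrow> bool" where
  "less_eq_zwvar v w \<longleftrightarrow> zwvar_code v \<le> zwvar_code w"

definition less_zwvar :: "zwvar \<Rightarrow> zwvar \<Rightarrow> bool" where
  "less_zwvar v w \<longleftrightarrow> zwvar_code v < zwvar_code w"

instance
proof
  fix v w :: zwvar
  assume "v \<le> w" "w \<le> v"
  then have "zwvar_code v = zwvar_code w"
    by (simp add: less_eq_zwvar_def)
  then show "v = w"
    by (cases v; cases w; simp; presburger)
qed (auto simp: less_eq_zwvar_def less_zwvar_def)

end

type_synonym 'k zwfun = "(zwvar, 'k poly fract) mpoly fract"

definition zw_var :: "zwvar \<Rightarrow> 'k::field zwfun" where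
  "zw_var v = to_fract (mvar v)"

definition zw_const :: "'k::field \<Rightarrow> 'k zwfun" where
  "zw_const c = to_fract (mconst (to_fract [:c:]))"

text \<open>\<open>chain_coeff j i\<close> is the coefficient, an element of \<open>\<bbbK>[z, z', \<dots>]\<close>, of the \<open>i\<close>-th
  derivative of \<open>y\<close> in \<open>S\<^sub>j\<close>.\<close>

primrec chain_coeff :: "nat \<Rightarrow> nat \<Rightarrow> 'k::field dpoly1" where
  "chain_coeff 0 = (\<lambda>i. if i = 0 then 1 else 0)"
| "chain_coeff (Suc j) = (\<lambda>i. dpoly_deriv (\<lambda>_. 0) Suc (chain_coeff j i)
      + (case i of 0 \<Rightarrow> 0 | Suc i' \<Rightarrow> chain_coeff j i' * mvar 1))"

definition zw_chain_coeff :: "nat \<Rightarrow> nat \<Rightarrow> 'k::field zwfun" where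
  "zw_chain_coeff j i = mpoly_eval zw_const (\<lambda>l. zw_var (Zd l)) (chain_coeff j i)"

text \<open>Forward substitution in the triangular system consisting of the equations
  \<open>zw_var (Wd j) = S\<^sub>j\<close>; the diagonal coefficient in row \<open>j\<close> is the \<open>j\<close>-th power of \<open>z'\<close>.\<close>

fun y_solution :: "nat \<Rightarrow> 'k::field zwfun" where
  "y_solution k =
     (zw_var (Wd k) - (\<Sum>i<k. zw_chain_coeff k i * y_solution i)) / zw_chain_coeff k k"

declare y_solution.simps [simp del]

definition x_to_z :: "'k::field poly fract \<Rightarrow> 'k zwfun" where
  "x_to_z = fract_eval (\<lambda>g. poly (map_poly zw_const g) (zw_var (Zd 0)))"

definition R_expr :: "'k::field poly fract dpoly1 \<Rightarrow> 'k zwfun" where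
  "R_expr p = mpoly_eval x_to_z y_solution p"

definition r_p :: "nat \<Rightarrow> 'k::field poly fract dpoly1 \<Rightarrow> 'k zwfun" where
  "r_p n p = solve_for (Wd n) (R_expr p)"

definition u_var :: "nat \<Rightarrow> 'k::field ufun" where
  "u_var i = to_fract (mvar i)"

definition u_const :: "'k::field poly fract \<Rightarrow> 'k ufun" where
  "u_const c = to_fract (mconst c)"

definition r_q :: "nat \<Rightarrow> 'k::field poly fract dpoly1 \<Rightarrow> 'k ufun" where
  "r_q m q = fract_eval (mpoly_eval u_const (\<lambda>j. u_var (Suc j))) (solve_for m (to_fract q))"

text \<open>The derivation on \<open>\<bbbK>(x)(u\<^sub>1, \<dots>, u\<^sub>m)\<close> given by \<open>u\<^sub>i' = u\<^sub>i\<^sub>+\<^sub>1\<close> for \<open>i < m\<close> and \<open>u\<^sub>m' = r\<close>.\<close>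

definition z_system_deriv :: "nat \<Rightarrow> 'k::field ufun \<Rightarrow> 'k ufun \<Rightarrow> 'k ufun" where
  "z_system_deriv m r f = quot_ext (Poly_Mapping.map dx) f
     + (\<Sum>i=1..m. quot_ext (pdiff i) f * (if i = m then r else u_var (Suc i)))"

text \<open>The \<open>j\<close>-th derivative of \<open>z\<close>, rewritten in terms of \<open>x, u\<^sub>1, \<dots>, u\<^sub>m\<close>.\<close>

definition z_rewritten :: "nat \<Rightarrow> 'k::field poly fract dpoly1 \<Rightarrow> nat \<Rightarrow> 'k ufun" where
  "z_rewritten m q j =
     (if j < m then u_var (Suc j) else (z_system_deriv m (r_q m q) ^^ (j - m)) (r_q m q))"

definition rewrite_zw ::
    "nat \<Rightarrow> 'k::field poly fract dpoly1 \<Rightarrow> (zwvar, 'k poly fract) mpoly \<Rightarrow> 'k ufun" where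
  "rewrite_zw m q = mpoly_eval u_const
     (\<lambda>v. case v of Zd j \<Rightarrow> z_rewritten m q j | Wd j \<Rightarrow> u_var (Suc (m + j)))"

definition r_p_rewritten ::
    "nat \<Rightarrow> 'k::field poly fract dpoly1 \<Rightarrow> nat \<Rightarrow> 'k poly fract dpoly1 \<Rightarrow> 'k ufun" where
  "r_p_rewritten n p m q = fract_eval (rewrite_zw m q) (r_p n p)"

text \<open>No denominator vanishes after rewriting. For \<open>n > 0\<close>, powers of \<open>z'\<close> do occur as denominators,
  and the condition is that \<open>z'\<close> does not become \<open>0\<close>. It suffices: \<open>z\<close> is then transcendental over
  the constants and the \<open>y_solution k\<close> with \<open>k < n\<close> stay algebraically independent, so that the
  coefficient of the \<open>n\<close>-th derivative of \<open>w\<close>, by which one divides to get \<open>r_p\<close>, does not vanish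
  either. For \<open>n = 0\<close> there is no \<open>z'\<close>, and the only denominator is that of \<open>r_p\<close>.\<close>

definition denominators_nonzero ::
    "nat \<Rightarrow> 'k::field poly fract dpoly1 \<Rightarrow> nat \<Rightarrow> 'k poly fract dpoly1 \<Rightarrow> bool" where
  "denominators_nonzero n p m q \<longleftrightarrow>
     (if n = 0 then fract_eval_defined (rewrite_zw m q) (r_p n p) else z_rewritten m q 1 \<noteq> 0)"

definition composition_model ::
    "nat \<Rightarrow> 'k::field poly fract dpoly1 \<Rightarrow> nat \<Rightarrow> 'k poly fract dpoly1 \<Rightarrow> 'k model" where
  "composition_model n p m q =
     \<lparr>dim = m + n,
      rhs = (\<lambda>i. if i < m then u_var (Suc i)
                 else if i = m then r_q m q
                 else if i < m + n then u_var (Suc i)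
                 else r_p_rewritten n p m q),
      out = (if n = 0 then r_p_rewritten n p m q else u_var (Suc m))\<rparr>"

end

theory Submission
  imports Defs "HOL-Library.FuncSet"
begin

text \<open>
  Let \<open>N = m + n\<close> be the number of states of the system and \<open>Q\<close> its common denominator.
  Modulo the differential ideal of the system, a suitable \<open>Q\<^sup>e w\<^sup>(\<^sup>j\<^sup>)\<close> is
  a polynomial in the states for every \<open>j\<close>. Hence, after multiplication by one fixed power of \<open>Q\<close>,
  the monomials in \<open>w, w', \<dots>, w\<^sup>(\<^sup>N\<^sup>)\<close> with exponents at most \<open>d\<close> become polynomials in \<open>N\<close> variables
  with exponents at most \<open>C d\<close>, where \<open>C\<close> does not depend on \<open>d\<close>. There are \<open>(d + 1)\<^sup>N\<^sup>+\<^sup>1\<close> such monomials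
  but only \<open>(C d + 1)\<^sup>N\<close> monomials in the states, so for large \<open>d\<close> a non-trivial linear
  combination lies in the ideal. Counting replaces the usual transcendence degree argument.
\<close>

section \<open>Variables and monomials\<close>

lemma vars_zero [simp]: "vars 0 = {}"
  by (simp add: vars_def)

lemma vars_one [simp]: "vars (1 :: ('v, 'a::zero_neq_one) mpoly) = {}"
  by (simp add: vars_def)

lemma vars_add: "vars (P + Q) \<subseteq> vars P \<union> vars Q"
  using Poly_Mapping.keys_add[of P Q] by (auto simp: vars_def)

lemma vars_sum: "vars (sum f A) \<subseteq> (\<Union>i\<in>A. vars (f i))"
proof (induction A rule: infinite_finite_induct)
  case (insert i A)
  then show ?case
    using vars_add[of "f i" "sum f A"] by auto
qed simp_all

lemma vars_prod: "vars (prod f A :: ('v, 'a::comm_ring_1) mpoly) \<subseteq> (\<Union>i\<in>A. vars (f i))"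
proof (induction A rule: infinite_finite_induct)
  case (insert i A)
  then show ?case
    using vars_mult[of "f i" "prod f A"] by auto
qed simp_all

lemma vars_power: "vars (P ^ k :: ('v, 'a::comm_ring_1) mpoly) \<subseteq> vars P"
proof (induction k)
  case (Suc k)
  then show ?case
    using vars_mult[of P "P ^ k"] by auto
qed simp

lemma vars_add_subset: "vars P \<subseteq> V \<Longrightarrow> vars Q \<subseteq> V \<Longrightarrow> vars (P + Q) \<subseteq> V"
  by (rule order_trans[OF vars_add Un_least])

lemma vars_mult_subset:
  fixes P Q :: "('v, 'a::comm_ring_1) mpoly"
  shows "vars P \<subseteq> V \<Longrightarrow> vars Q \<subseteq> V \<Longrightarrow> vars (P * Q) \<subseteq> V"
  by (rule order_trans[OF vars_mult Un_least])

lemma vars_mconst [simp]: "vars (mconst c) = {}"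
  by (simp add: vars_def mconst_def)

lemma vars_mvar [simp]: "vars (mvar v :: ('v, 'a::zero_neq_one) mpoly) = {v}"
  by (simp add: vars_def mvar_def)

lemma mconst_add: "mconst (c + d) = mconst c + mconst d"
  by (simp add: mconst_def single_add)

lemma mconst_mult: "mconst (c * d) = mconst c * mconst d"
  by (simp add: mconst_def mult_single)

lemma single_eq_mconst_mult:
  "Poly_Mapping.single t c = mconst c * Poly_Mapping.single t (1 :: 'a::comm_ring_1)"
  by (simp add: mconst_def mult_single)

lemma sum_singles:
  assumes "finite T" "Poly_Mapping.keys P \<subseteq> T"
  shows "(\<Sum>t\<in>T. Poly_Mapping.single t (Poly_Mapping.lookup P t)) = P"
  using assms
  by (intro poly_mapping_eqI) (auto simp: lookup_sum lookup_single when_def in_keys_iff)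

lemma single_power_mvar:
  "Poly_Mapping.single (Poly_Mapping.single v k) (1 :: 'a::comm_ring_1) = mvar v ^ k"
proof (induction k)
  case (Suc k)
  have "Poly_Mapping.single v (Suc k) = Poly_Mapping.single v 1 + Poly_Mapping.single v k"
    by (simp flip: single_add)
  then have "Poly_Mapping.single (Poly_Mapping.single v (Suc k)) (1 :: 'a)
      = mvar v * Poly_Mapping.single (Poly_Mapping.single v k) 1"
    by (simp add: mvar_def mult_single)
  then show ?case
    using Suc by simp
qed simp

lemma single_eq_prod_mvar:
  fixes t :: "'v \<Rightarrow>\<^sub>0 nat"
  assumes "finite V" "Poly_Mapping.keys t \<subseteq> V"
  shows "Poly_Mapping.single t (1 :: 'a::comm_ring_1)
    = (\<Prod>v\<in>V. mvar v ^ Poly_Mapping.lookup t v)"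
proof -
  have "Poly_Mapping.single (\<Sum>v\<in>V. Poly_Mapping.single v (Poly_Mapping.lookup t v)) (1 :: 'a)
    = (\<Prod>v\<in>V. mvar v ^ Poly_Mapping.lookup t v)"
    using assms(1)
  proof (induction V)
    case (insert v V)
    have "Poly_Mapping.single (a + b) (1 :: 'a) = Poly_Mapping.single a 1 * Poly_Mapping.single b 1"
      for a b :: "'v \<Rightarrow>\<^sub>0 nat"
      by (simp add: mult_single)
    with insert show ?case
      by (simp add: single_power_mvar)
  qed simp
  then show ?thesis
    using sum_singles[OF assms] by simp
qed

text \<open>Polynomials are built from constants and variables by sums and products. Fixing
  \<open>V\<close> beforehand keeps the bound on the variables available for both operands.\<close>

lemma mpoly_induct_on [consumes 1, case_names const var add mult]:
  fixes P :: "('v, 'a::comm_ring_1) mpoly"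
  assumes "vars P \<subseteq> V"
    and const: "\<And>c. \<Phi> (mconst c)"
    and var: "\<And>v. v \<in> V \<Longrightarrow> \<Phi> (mvar v)"
    and add: "\<And>P Q. vars P \<subseteq> V \<Longrightarrow> vars Q \<subseteq> V \<Longrightarrow> \<Phi> P \<Longrightarrow> \<Phi> Q \<Longrightarrow> \<Phi> (P + Q)"
    and mult: "\<And>P Q. vars P \<subseteq> V \<Longrightarrow> vars Q \<subseteq> V \<Longrightarrow> \<Phi> P \<Longrightarrow> \<Phi> Q \<Longrightarrow> \<Phi> (P * Q)"
  shows "\<Phi> P"
proof -
  have one: "\<Phi> 1" and zero: "\<Phi> 0"
    using const[of 1] const[of 0] by (simp_all add: mconst_def)
  \<comment> \<open>\<open>C\<close> carries the bound on the variables along with \<Phi>, since the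
    hypotheses on sums and products ask for it.\<close>
  define C where "C = {P. vars P \<subseteq> V \<and> \<Phi> P}"
  have C_mult: "A * B \<in> C" if "A \<in> C" "B \<in> C" for A B
    using that mult vars_mult[of A B] unfolding C_def by blast
  have C_add: "A + B \<in> C" if "A \<in> C" "B \<in> C" for A B
    using that add vars_add[of A B] unfolding C_def by blast
  have C_pow: "A ^ k \<in> C" if "A \<in> C" for A k
    by (induction k) (use that one C_mult in \<open>auto simp: C_def\<close>)
  have C_prod: "prod f I \<in> C" if "\<And>i. i \<in> I \<Longrightarrow> f i \<in> C" for f :: "'v \<Rightarrow> _" and I
    using that by (induction I rule: infinite_finite_induct) (use one C_mult in \<open>auto simp: C_def\<close>)
  have C_sum: "sum f I \<in> C" if "\<And>i. i \<in> I \<Longrightarrow> f i \<in> C" for f :: "('v \<Rightarrow>\<^sub>0 nat) \<Rightarrow> _" and I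
    using that by (induction I rule: infinite_finite_induct) (use zero C_add in \<open>auto simp: C_def\<close>)
  have C_var: "mvar v \<in> C" if "v \<in> V" for v
    using that var by (simp add: C_def)
  have "Poly_Mapping.single t c \<in> C" if "t \<in> Poly_Mapping.keys P" for t c
  proof -
    have "Poly_Mapping.keys t \<subseteq> V"
      using assms(1) that by (auto simp: vars_def)
    then have "Poly_Mapping.single t 1 \<in> C"
      using var by (subst single_eq_prod_mvar[of "Poly_Mapping.keys t"])
        (auto intro!: C_prod C_pow C_var)
    then show ?thesis
      using C_mult[of "mconst c"] const by (subst single_eq_mconst_mult) (simp add: C_def)
  qed
  then have "(\<Sum>t\<in>Poly_Mapping.keys P. Poly_Mapping.single t (Poly_Mapping.lookup P t)) \<in> C"
    by (intro C_sum)
  then show ?thesis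
    by (simp add: sum_singles C_def)
qed

lemma vars_mpoly_eval_mconst:
  fixes P :: "('v, 'a::comm_ring_1) mpoly" and \<sigma> :: "'v \<Rightarrow> ('w, 'a) mpoly"
  shows "vars (mpoly_eval mconst \<sigma> P) \<subseteq> (\<Union>v\<in>vars P. vars (\<sigma> v))"
proof -
  have "vars (mconst (Poly_Mapping.lookup P t) *
      (\<Prod>v\<in>Poly_Mapping.keys t. \<sigma> v ^ Poly_Mapping.lookup t v)) \<subseteq> (\<Union>v\<in>vars P. vars (\<sigma> v))"
    (is "vars (_ * ?M) \<subseteq> _") if t: "t \<in> Poly_Mapping.keys P" for t
  proof -
    have "vars ?M \<subseteq> (\<Union>v\<in>Poly_Mapping.keys t. vars (\<sigma> v ^ Poly_Mapping.lookup t v))"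
      by (rule vars_prod)
    also have "\<dots> \<subseteq> (\<Union>v\<in>vars P. vars (\<sigma> v))"
      using t by (intro UN_mono vars_power) (auto simp: vars_def[of P])
    finally show ?thesis
      using vars_mult[of "mconst (Poly_Mapping.lookup P t)" ?M] by simp
  qed
  then show ?thesis
    unfolding mpoly_eval_def by (intro order_trans[OF vars_sum] UN_least)
qed


section \<open>Polynomials with bounded exponents\<close>

text \<open>Bounding each exponent separately, instead of the total degree, makes the number of
  monomials exactly a power, and the bounds still add up under multiplication.\<close>

definition exponent_box :: "'v set \<Rightarrow> nat \<Rightarrow> ('v \<Rightarrow>\<^sub>0 nat) set" where
  "exponent_box V k = {t. Poly_Mapping.keys t \<subseteq> V \<and> (\<forall>v. Poly_Mapping.lookup t v \<le> k)}"

lemma exponent_box_card: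
  assumes "finite V"
  shows "finite (exponent_box V k)" "card (exponent_box V k) = Suc k ^ card V"
proof -
  have "bij_betw (\<lambda>t. restrict (Poly_Mapping.lookup t) V) (exponent_box V k) (PiE V (\<lambda>_. {..k}))"
  proof (rule bij_betw_byWitness[where f' = "\<lambda>f. Abs_poly_mapping (\<lambda>v. if v \<in> V then f v else 0)"])
    show "\<forall>t\<in>exponent_box V k.
        Abs_poly_mapping (\<lambda>v. if v \<in> V then restrict (Poly_Mapping.lookup t) V v else 0) = t"
    proof
      fix t assume "t \<in> exponent_box V k"
      then have "(\<lambda>v. if v \<in> V then restrict (Poly_Mapping.lookup t) V v else 0)
          = Poly_Mapping.lookup t"
        by (auto simp: exponent_box_def in_keys_iff fun_eq_iff)
      then show "Abs_poly_mapping (\<lambda>v. if v \<in> V then restrict (Poly_Mapping.lookup t) V v else 0) = t"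
        by simp
    qed
    \<comment> \<open>\<open>Abs_poly_mapping\<close> gives back a function only if its support is
      finite; the finiteness of \<open>V\<close> ensures this.\<close>
    have *: "Poly_Mapping.lookup (Abs_poly_mapping (\<lambda>v. if v \<in> V then f v else 0))
        = (\<lambda>v. if v \<in> V then f v else 0)" for f :: "_ \<Rightarrow> nat"
    proof (rule lookup_Abs_poly_mapping)
      have "{x. (if x \<in> V then f x else 0) \<noteq> 0} \<subseteq> V"
        by auto
      then show "finite {x. (if x \<in> V then f x else 0) \<noteq> 0}"
        using assms by (rule finite_subset)
    qed
    show "\<forall>f\<in>PiE V (\<lambda>_. {..k}).
        restrict (Poly_Mapping.lookup (Abs_poly_mapping (\<lambda>v. if v \<in> V then f v else 0))) V = f"
    proof (intro ballI ext)
      fix f v assume f: "f \<in> PiE V (\<lambda>_. {..k})"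
      show "restrict (Poly_Mapping.lookup (Abs_poly_mapping (\<lambda>v. if v \<in> V then f v else 0))) V v
          = f v"
        unfolding * using PiE_arb[OF f] by (cases "v \<in> V") simp_all
    qed
    show "(\<lambda>f. Abs_poly_mapping (\<lambda>v. if v \<in> V then f v else 0)) ` (PiE V (\<lambda>_. {..k}))
        \<subseteq> exponent_box V k"
    proof (rule image_subsetI)
      fix f assume "f \<in> PiE V (\<lambda>_. {..k})"
      then show "Abs_poly_mapping (\<lambda>v. if v \<in> V then f v else 0) \<in> exponent_box V k"
        unfolding exponent_box_def mem_Collect_eq subset_iff in_keys_iff * by (simp add: PiE_iff)
    qed
    show "(\<lambda>t. restrict (Poly_Mapping.lookup t) V) ` exponent_box V k \<subseteq> PiE V (\<lambda>_. {..k})"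
      by (auto simp: exponent_box_def)
  qed
  then show "finite (exponent_box V k)" "card (exponent_box V k) = Suc k ^ card V"
    using assms by (simp_all add: bij_betw_finite bij_betw_same_card card_PiE finite_PiE)
qed

definition box_polys :: "'v set \<Rightarrow> nat \<Rightarrow> ('v, 'a::zero) mpoly set" where
  "box_polys V k = {P. Poly_Mapping.keys P \<subseteq> exponent_box V k}"

lemma box_polys_mono: "k \<le> l \<Longrightarrow> box_polys V k \<subseteq> box_polys V l"
  unfolding box_polys_def exponent_box_def by (blast intro: le_trans)

lemma box_polys_one: "(1 :: ('v, 'a::zero_neq_one) mpoly) \<in> box_polys V k"
  by (simp add: box_polys_def exponent_box_def)

lemma box_polys_mult:
  assumes "P \<in> box_polys V k" "Q \<in> box_polys V l"
  shows "P * Q \<in> box_polys V (k + l)"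
proof -
  have "s + t \<in> exponent_box V (k + l)" if "s \<in> exponent_box V k" "t \<in> exponent_box V l" for s t
    using that Poly_Mapping.keys_add[of s t] by (auto simp: exponent_box_def lookup_add add_mono)
  then show ?thesis
    using assms Poly_Mapping.keys_mult[of P Q] unfolding box_polys_def by blast
qed

lemma box_polys_power:
  fixes P :: "('v, 'a::comm_ring_1) mpoly"
  assumes "P \<in> box_polys V k"
  shows "P ^ i \<in> box_polys V (i * k)"
  by (induction i) (use assms in \<open>auto simp: box_polys_one intro: box_polys_mult\<close>)

lemma box_polys_prod:
  fixes f :: "'i \<Rightarrow> ('v, 'a::comm_ring_1) mpoly"
  assumes "\<And>i. i \<in> I \<Longrightarrow> f i \<in> box_polys V (k i)"
  shows "prod f I \<in> box_polys V (sum k I)"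
  using assms
  by (induction I rule: infinite_finite_induct) (auto simp: box_polys_one intro: box_polys_mult)

lemma ex_box_polys:
  fixes P :: "('v, 'a::comm_ring_1) mpoly"
  assumes "vars P \<subseteq> V"
  shows "\<exists>k. P \<in> box_polys V k"
  using assms
proof (induction rule: mpoly_induct_on)
  case (const c)
  show ?case
    by (simp add: box_polys_def exponent_box_def mconst_def)
next
  case (var v)
  then have "mvar v \<in> box_polys V 1"
    by (auto simp: box_polys_def exponent_box_def mvar_def lookup_single when_def)
  then show ?case ..
next
  case (add P Q)
  then obtain k l where "P \<in> box_polys V k" "Q \<in> box_polys V l"
    by blast
  then have "P \<in> box_polys V (max k l)" "Q \<in> box_polys V (max k l)"
    using box_polys_mono max.cobounded1 max.cobounded2 by blast+
  then have "P + Q \<in> box_polys V (max k l)"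
    using Poly_Mapping.keys_add[of P Q] by (auto simp: box_polys_def)
  then show ?case ..
next
  case (mult P Q)
  then show ?case
    using box_polys_mult by blast
qed

text \<open>All \<open>g i\<close> lie in the span of the \<open>card T\<close> monomials, which has
  no room for \<open>card I\<close> independent vectors. A family may repeat values whereas
  independence is a property of sets, hence the case distinction.\<close>

lemma linearly_dependent_mpolys:
  fixes g :: "'i \<Rightarrow> ('v, 'a::field) mpoly"
  assumes "finite I" "finite T" "card T < card I"
    and keys: "\<And>i. i \<in> I \<Longrightarrow> Poly_Mapping.keys (g i) \<subseteq> T"
  obtains \<alpha> where "\<exists>i\<in>I. \<alpha> i \<noteq> 0" "(\<Sum>i\<in>I. mconst (\<alpha> i) * g i) = 0"
proof (cases "inj_on g I")
  case False
  then obtain i j where ij: "i \<in> I" "j \<in> I" "i \<noteq> j" "g i = g j"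
    by (auto simp: inj_on_def)
  \<comment> \<open>A repeated value gives the relation \<open>g i - g j = 0\<close>.\<close>
  define \<alpha> :: "'i \<Rightarrow> 'a" where "\<alpha> k = (if k = i then 1 else if k = j then - 1 else 0)" for k
  have "(\<Sum>k\<in>I. mconst (\<alpha> k) * g k) = (\<Sum>k\<in>{i, j}. mconst (\<alpha> k) * g k)"
    using assms(1) ij by (intro sum.mono_neutral_right) (auto simp: \<alpha>_def mconst_def)
  also have "\<dots> = 0"
    using ij by (simp add: \<alpha>_def mconst_def single_uminus)
  finally show ?thesis
    using ij(1) by (intro that[of \<alpha>]) (auto simp: \<alpha>_def)
next
  case True
  interpret vector_space "\<lambda>c P. mconst c * P :: ('v, 'a) mpoly"
    by unfold_locales (simp_all add: algebra_simps mconst_add mconst_mult, simp add: mconst_def)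
  define B where "B = (\<lambda>t. Poly_Mapping.single t (1 :: 'a)) ` T"
  have "g i \<in> span B" if "i \<in> I" for i
  proof -
    have "(\<Sum>t\<in>T. mconst (Poly_Mapping.lookup (g i) t) * Poly_Mapping.single t 1) \<in> span B"
      by (intro span_sum span_scale span_base) (auto simp: B_def)
    then show ?thesis
      using sum_singles[OF assms(2) keys[OF that]] by (simp flip: single_eq_mconst_mult)
  qed
  moreover have "card B < card (g ` I)" "finite B"
    using card_image[OF True] card_image_le[OF assms(2), of "\<lambda>t. Poly_Mapping.single t (1 :: 'a)"]
      assms(2,3) by (auto simp: B_def)
  ultimately have "dependent (g ` I)"
    using independent_span_bound[of B "g ` I"] by fastforce
  then obtain u where u: "\<exists>P\<in>g ` I. u P \<noteq> 0" "(\<Sum>P\<in>g ` I. mconst (u P) * P) = 0"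
    using assms(1) by (auto simp: dependent_finite)
  moreover have "(\<Sum>i\<in>I. mconst (u (g i)) * g i) = (\<Sum>P\<in>g ` I. mconst (u P) * P)"
    using True by (simp add: sum.reindex)
  ultimately show ?thesis
    by (intro that[of "u \<circ> g"]) auto
qed


section \<open>Derivations\<close>

text \<open>The same laws serve for \<open>pderiv\<close> on polynomials in x, for \<open>dx\<close>
  on rational functions and for \<open>sys_deriv\<close> on differential polynomials.\<close>

locale derivation =
  fixes \<delta> :: "'a::comm_ring_1 \<Rightarrow> 'a"
  assumes add: "\<delta> (x + y) = \<delta> x + \<delta> y"
    and leibniz: "\<delta> (x * y) = \<delta> x * y + x * \<delta> y"
begin

lemma zero [simp]: "\<delta> 0 = 0"
  using add[of 0 0] by simp

lemma one [simp]: "\<delta> 1 = 0"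
  using leibniz[of 1 1] by simp

lemma diff: "\<delta> (x - y) = \<delta> x - \<delta> y"
  using add[of "x - y" y] by simp

lemma sum: "\<delta> (sum f A) = (\<Sum>i\<in>A. \<delta> (f i))"
  by (induction A rule: infinite_finite_induct) (simp_all add: add)

end

text \<open>Once denominators are cleared, both laws are identities in the numerators, the
  denominators and their derivatives.\<close>

lemma derivation_quot_ext:
  fixes d :: "'a::idom \<Rightarrow> 'a"
  assumes "derivation d"
  shows "derivation (quot_ext d)"
proof
  interpret derivation d by fact
  note quot = quot_ext_Fract[of d, OF leibniz]
  fix f g :: "'a fract"
  obtain x y where f: "f = Fract x y" "y \<noteq> 0" by (cases f)
  obtain u v where g: "g = Fract u v" "v \<noteq> 0" by (cases g)
  show "quot_ext d (f + g) = quot_ext d f + quot_ext d g"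
    using f g by (simp add: quot add leibniz eq_fract) (simp add: algebra_simps power2_eq_square)
  show "quot_ext d (f * g) = quot_ext d f * g + f * quot_ext d g"
    using f g by (simp add: quot add leibniz eq_fract) (simp add: algebra_simps power2_eq_square)
qed

lemma derivation_dx: "derivation (dx :: 'k::field poly fract \<Rightarrow> _)"
  unfolding dx_def
  by (intro derivation_quot_ext derivation.intro) (simp_all add: pderiv_add pderiv_mult)

section \<open>The derivation of differential polynomials that extends a derivation of the
  coefficients\<close>

context derivation
begin

text \<open>The contribution of a single term to \<open>dpoly_deriv\<close>. For fixed
  \<open>t\<close> it is additive in \<open>c\<close>, so that derivatives of polynomials can be
  added monomial by monomial.\<close>

definition monomial_deriv :: "('v \<Rightarrow> 'v) \<Rightarrow> ('v \<Rightarrow>\<^sub>0 nat) \<Rightarrow> 'a \<Rightarrow> ('v, 'a) mpoly" where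
  "monomial_deriv s t c = Poly_Mapping.single t (\<delta> c) +
     (\<Sum>v\<in>Poly_Mapping.keys t. Poly_Mapping.single (t - Poly_Mapping.single v 1)
        (of_nat (Poly_Mapping.lookup t v) * c) * mvar (s v))"

text \<open>Variables outside \<open>t\<close> have exponent 0 and contribute nothing. A common
  \<open>V\<close> allows the derivatives of \<open>t\<close>, \<open>u\<close> and
  \<open>t + u\<close> to be compared variable by variable.\<close>

lemma monomial_deriv_superset:
  assumes "finite V" "Poly_Mapping.keys t \<subseteq> V"
  shows "monomial_deriv s t c = Poly_Mapping.single t (\<delta> c) +
     (\<Sum>v\<in>V. Poly_Mapping.single (t - Poly_Mapping.single v 1)
        (of_nat (Poly_Mapping.lookup t v) * c) * mvar (s v))"
  unfolding monomial_deriv_def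
  using assms by (intro arg_cong2[of _ _ _ _ "(+)"] sum.mono_neutral_left refl)
    (auto simp: in_keys_iff)

lemma monomial_deriv_zero [simp]: "monomial_deriv s t 0 = 0"
  by (simp add: monomial_deriv_def)

lemma monomial_deriv_add:
  "monomial_deriv s t (c + d) = monomial_deriv s t c + monomial_deriv s t d"
  by (simp add: monomial_deriv_def add single_add algebra_simps sum.distrib)

text \<open>The product rule holds for each variable separately, because its exponent in
  \<open>t + u\<close> is the sum of its exponents in \<open>t\<close> and \<open>u\<close>.\<close>

lemma monomial_deriv_mult:
  "monomial_deriv s (t + u) (c * d)
    = monomial_deriv s t c * Poly_Mapping.single u d + Poly_Mapping.single t c * monomial_deriv s u d"
proof -
  define V where "V = Poly_Mapping.keys t \<union> Poly_Mapping.keys u"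
  have V: "finite V" "Poly_Mapping.keys t \<subseteq> V" "Poly_Mapping.keys u \<subseteq> V"
    "Poly_Mapping.keys (t + u) \<subseteq> V"
    using Poly_Mapping.keys_add[of t u] by (auto simp: V_def)
  have "Poly_Mapping.single (t + u - Poly_Mapping.single v 1)
        (of_nat (Poly_Mapping.lookup (t + u) v) * (c * d))
      = Poly_Mapping.single (t - Poly_Mapping.single v 1) (of_nat (Poly_Mapping.lookup t v) * c)
          * Poly_Mapping.single u d
        + Poly_Mapping.single t c *
          Poly_Mapping.single (u - Poly_Mapping.single v 1) (of_nat (Poly_Mapping.lookup u v) * d)"
    for v
  proof -
    \<comment> \<open>Subtraction of exponents is truncated, so the shift requires that
      \<open>v\<close> occurs. If it does not, the factor \<open>of_nat 0\<close> removes the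
      term.\<close>
    have shift: "r + q - Poly_Mapping.single v 1 = (r - Poly_Mapping.single v 1) + q"
      if "Poly_Mapping.lookup r v \<noteq> 0" for r q :: "_ \<Rightarrow>\<^sub>0 nat"
      using that by (intro poly_mapping_eqI) (auto simp: lookup_add lookup_minus lookup_single when_def)
    have t: "Poly_Mapping.single (t - Poly_Mapping.single v 1) (of_nat (Poly_Mapping.lookup t v) * c)
          * Poly_Mapping.single u d
        = Poly_Mapping.single (t + u - Poly_Mapping.single v 1)
            (of_nat (Poly_Mapping.lookup t v) * (c * d))"
      using shift[of t u] by (cases "Poly_Mapping.lookup t v = 0") (simp_all add: mult_single ac_simps)
    have u: "Poly_Mapping.single t c *
          Poly_Mapping.single (u - Poly_Mapping.single v 1) (of_nat (Poly_Mapping.lookup u v) * d)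
        = Poly_Mapping.single (t + u - Poly_Mapping.single v 1)
            (of_nat (Poly_Mapping.lookup u v) * (c * d))"
      using shift[of u t] by (cases "Poly_Mapping.lookup u v = 0") (simp_all add: mult_single ac_simps)
    show ?thesis
      unfolding t u by (simp add: lookup_add ring_distribs single_add)
  qed
  then show ?thesis
    unfolding monomial_deriv_superset[OF V(1,2)] monomial_deriv_superset[OF V(1,3)]
      monomial_deriv_superset[OF V(1,4)]
    by (simp add: leibniz single_add mult_single ring_distribs sum.distrib sum_distrib_left
        sum_distrib_right ac_simps)
qed

text \<open>Exchanging the sums over variables and monomials turns the operator into a termwise one.
  An arbitrary \<open>T\<close> provides one index set for \<open>P\<close>, \<open>Q\<close> and
  \<open>P + Q\<close>.\<close>

lemma dpoly_deriv_eq_sum: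
  assumes "finite T" "Poly_Mapping.keys P \<subseteq> T"
  shows "dpoly_deriv \<delta> s P = (\<Sum>t\<in>T. monomial_deriv s t (Poly_Mapping.lookup P t))"
proof -
  \<comment> \<open>\<open>Poly_Mapping.map\<close> applies \<delta> to the non-zero coefficients
    only; the equation holds at the others because \<delta> sends 0 to 0.\<close>
  have "Poly_Mapping.lookup (Poly_Mapping.map \<delta> P) t = \<delta> (Poly_Mapping.lookup P t)" for t
    by (simp add: Poly_Mapping.map.rep_eq when_def)
  moreover from this have "Poly_Mapping.keys (Poly_Mapping.map \<delta> P) \<subseteq> Poly_Mapping.keys P"
    by (auto simp: in_keys_iff)
  ultimately have map: "Poly_Mapping.map \<delta> P
      = (\<Sum>t\<in>Poly_Mapping.keys P. Poly_Mapping.single t (\<delta> (Poly_Mapping.lookup P t)))"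
    using sum_singles[of "Poly_Mapping.keys P" "Poly_Mapping.map \<delta> P"] by simp
  have vars: "finite (vars P)" "Poly_Mapping.keys t \<subseteq> vars P" if "t \<in> Poly_Mapping.keys P" for t
    using that by (auto simp: vars_def)
  have "dpoly_deriv \<delta> s P
      = (\<Sum>t\<in>Poly_Mapping.keys P. monomial_deriv s t (Poly_Mapping.lookup P t))"
    unfolding dpoly_deriv_def map pdiff_def sum_distrib_right
    by (subst sum.swap) (simp add: monomial_deriv_superset[OF vars] flip: sum.distrib)
  also have "\<dots> = (\<Sum>t\<in>T. monomial_deriv s t (Poly_Mapping.lookup P t))"
    using assms by (intro sum.mono_neutral_left) (auto simp: in_keys_iff)
  finally show ?thesis .
qed

lemma dpoly_deriv_single: "dpoly_deriv \<delta> s (Poly_Mapping.single t c) = monomial_deriv s t c"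
  using dpoly_deriv_eq_sum[of "{t}" "Poly_Mapping.single t c"] by simp

lemma dpoly_deriv_mconst: "dpoly_deriv \<delta> s (mconst c) = mconst (\<delta> c)"
  by (simp add: mconst_def dpoly_deriv_single monomial_deriv_def)

lemma dpoly_deriv_mvar: "dpoly_deriv \<delta> s (mvar v) = mvar (s v)"
  by (simp add: mvar_def dpoly_deriv_single monomial_deriv_def)

lemma dpoly_deriv_add: "dpoly_deriv \<delta> s (P + Q) = dpoly_deriv \<delta> s P + dpoly_deriv \<delta> s Q"
proof -
  define T where "T = Poly_Mapping.keys P \<union> Poly_Mapping.keys Q"
  have "finite T" "Poly_Mapping.keys P \<subseteq> T" "Poly_Mapping.keys Q \<subseteq> T"
    "Poly_Mapping.keys (P + Q) \<subseteq> T"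
    using Poly_Mapping.keys_add[of P Q] by (auto simp: T_def)
  then show ?thesis
    by (simp add: dpoly_deriv_eq_sum[of T] lookup_add monomial_deriv_add sum.distrib)
qed

lemma dpoly_deriv_sum: "dpoly_deriv \<delta> s (sum f A) = (\<Sum>i\<in>A. dpoly_deriv \<delta> s (f i))"
  by (induction A rule: infinite_finite_induct)
    (simp_all add: dpoly_deriv_add dpoly_deriv_eq_sum[of "{}"])

text \<open>Both sides of the Leibniz rule are additive in each factor, so it is enough to check it
  on single terms.\<close>

lemma derivation_dpoly_deriv:
  fixes s :: "'v \<Rightarrow> 'v"
  shows "derivation (dpoly_deriv \<delta> s)"
proof
  fix P Q :: "('v, 'a) mpoly"
  show "dpoly_deriv \<delta> s (P + Q) = dpoly_deriv \<delta> s P + dpoly_deriv \<delta> s Q"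
    by (rule dpoly_deriv_add)
  let ?m = "\<lambda>P t. Poly_Mapping.single t (Poly_Mapping.lookup P t) :: ('v, 'a) mpoly"
  let ?D = "dpoly_deriv \<delta> s"
  have P: "P = sum (?m P) (Poly_Mapping.keys P)" and Q: "Q = sum (?m Q) (Poly_Mapping.keys Q)"
    by (simp_all add: sum_singles)
  have "?D (sum (?m P) A * sum (?m Q) B)
      = ?D (sum (?m P) A) * sum (?m Q) B + sum (?m P) A * ?D (sum (?m Q) B)" for A B
  proof -
    have "?D (?m P t * ?m Q u) = ?D (?m P t) * ?m Q u + ?m P t * ?D (?m Q u)" for t u
      by (simp add: mult_single dpoly_deriv_single monomial_deriv_mult)
    then show ?thesis
      by (simp only: sum_product dpoly_deriv_sum sum.distrib)
  qed
  from this[of "Poly_Mapping.keys P" "Poly_Mapping.keys Q"]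
  show "?D (P * Q) = ?D P * Q + P * ?D Q"
    by (simp flip: P Q)
qed

lemma vars_dpoly_deriv:
  assumes "vars P \<subseteq> V" "s ` V \<subseteq> V"
  shows "vars (dpoly_deriv \<delta> s P) \<subseteq> V"
  using assms(1)
proof (induction rule: mpoly_induct_on)
  case (const c)
  then show ?case by (simp add: dpoly_deriv_mconst)
next
  case (var v)
  then show ?case using assms(2) by (auto simp: dpoly_deriv_mvar)
next
  case (add P Q)
  then show ?case
    unfolding dpoly_deriv_add by (intro vars_add_subset)
next
  case (mult P Q)
  interpret D: derivation "dpoly_deriv \<delta> s"
    by (rule derivation_dpoly_deriv)
  from mult show ?case
    unfolding D.leibniz by (intro vars_add_subset vars_mult_subset)
qed

end


section \<open>Ideals generated over a subring\<close>

text \<open>The ring of the system is a subset of the polynomials in all \<open>Ud i j\<close> and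
  \<open>Od j\<close>, not a type of its own. Ideals therefore have to restrict their coefficients
  to a carrier.\<close>

locale subring =
  fixes R :: "'a::comm_ring_1 set"
  assumes one: "1 \<in> R"
    and add: "x \<in> R \<Longrightarrow> y \<in> R \<Longrightarrow> x + y \<in> R"
    and mult: "x \<in> R \<Longrightarrow> y \<in> R \<Longrightarrow> x * y \<in> R"
    and uminus: "x \<in> R \<Longrightarrow> - x \<in> R"
begin

lemma zero: "0 \<in> R"
  using add[OF one uminus[OF one]] by simp

lemma power: "x \<in> R \<Longrightarrow> x ^ k \<in> R"
  by (induction k) (auto simp: one mult)

lemma ideal_generated_zero: "0 \<in> ideal_generated R S"
  unfolding ideal_generated_def by (auto intro!: exI[of _ "{}"])

lemma ideal_generated_base:
  assumes "s \<in> S"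
  shows "s \<in> ideal_generated R S"
proof -
  have "s = (\<Sum>x\<in>{s}. 1 * x)"
    by simp
  with assms one show ?thesis
    unfolding ideal_generated_def by fast
qed

lemma ideal_generated_mult:
  assumes "r \<in> R" "x \<in> ideal_generated R S"
  shows "r * x \<in> ideal_generated R S"
proof -
  from assms(2) obtain T c where "x = (\<Sum>s\<in>T. c s * s)" "finite T" "T \<subseteq> S" "\<forall>s\<in>T. c s \<in> R"
    unfolding ideal_generated_def by blast
  with assms(1) have "r * x = (\<Sum>s\<in>T. (r * c s) * s)" "\<forall>s\<in>T. r * c s \<in> R"
    by (auto simp: sum_distrib_left mult.assoc mult)
  with \<open>finite T\<close> \<open>T \<subseteq> S\<close> show ?thesis
    unfolding ideal_generated_def
    by (intro CollectI exI[of _ T] exI[of _ "\<lambda>s. r * c s"]) auto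
qed

lemma ideal_generated_add:
  assumes "x \<in> ideal_generated R S" "y \<in> ideal_generated R S"
  shows "x + y \<in> ideal_generated R S"
proof -
  from assms(1) obtain T c
    where x: "x = (\<Sum>s\<in>T. c s * s)" and T: "finite T" "T \<subseteq> S" "\<forall>s\<in>T. c s \<in> R"
    unfolding ideal_generated_def by blast
  from assms(2) obtain U d
    where y: "y = (\<Sum>s\<in>U. d s * s)" and U: "finite U" "U \<subseteq> S" "\<forall>s\<in>U. d s \<in> R"
    unfolding ideal_generated_def by blast
  \<comment> \<open>Coefficients are extended by 0 to the union of the two index sets, so that they
    add up on the overlap.\<close>
  define e where "e s = (if s \<in> T then c s else 0) + (if s \<in> U then d s else 0)" for s
  have "x = (\<Sum>s\<in>T \<union> U. (if s \<in> T then c s else 0) * s)"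
    unfolding x using T(1) U(1) by (intro sum.mono_neutral_cong_left) auto
  moreover have "y = (\<Sum>s\<in>T \<union> U. (if s \<in> U then d s else 0) * s)"
    unfolding y using T(1) U(1) by (intro sum.mono_neutral_cong_left) auto
  ultimately have "x + y = (\<Sum>s\<in>T \<union> U. e s * s)"
    unfolding e_def by (simp only: distrib_right sum.distrib)
  moreover have "\<forall>s\<in>T \<union> U. e s \<in> R"
    using T(3) U(3) by (auto simp: e_def zero add)
  ultimately show ?thesis
    using T(1,2) U(1,2) unfolding ideal_generated_def
    by (intro CollectI exI[of _ "T \<union> U"] exI[of _ e]) auto
qed

lemma ideal_generated_sum:
  "(\<And>i. i \<in> A \<Longrightarrow> f i \<in> ideal_generated R S) \<Longrightarrow> sum f A \<in> ideal_generated R S"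
  by (induction A rule: infinite_finite_induct)
    (auto intro: ideal_generated_zero ideal_generated_add)

text \<open>In \<open>D (c * s) = D c * s + c * D s\<close> both summands are multiples of
  generators, as \<open>R\<close> and \<open>S\<close> are closed under \<open>D\<close>.\<close>

lemma ideal_generated_derivation:
  assumes "derivation D" "\<And>r. r \<in> R \<Longrightarrow> D r \<in> R" "\<And>s. s \<in> S \<Longrightarrow> D s \<in> S"
    and x: "x \<in> ideal_generated R S"
  shows "D x \<in> ideal_generated R S"
proof -
  interpret derivation D by fact
  from x obtain T c where T: "x = (\<Sum>s\<in>T. c s * s)" "T \<subseteq> S" "\<forall>s\<in>T. c s \<in> R"
    unfolding ideal_generated_def by blast
  have "D c * s + c * D s \<in> ideal_generated R S" if "c \<in> R" "s \<in> S" for c s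
    using that assms(2,3)
    by (intro ideal_generated_add ideal_generated_mult ideal_generated_base) auto
  then show ?thesis
    unfolding T(1) sum leibniz using T(2,3) by (intro ideal_generated_sum) auto
qed

section \<open>Congruence modulo an ideal\<close>

definition cong_mod :: "'a set \<Rightarrow> 'a \<Rightarrow> 'a \<Rightarrow> bool" where
  "cong_mod S x y \<longleftrightarrow> x \<in> R \<and> y \<in> R \<and> x - y \<in> ideal_generated R S"

lemma cong_mod_refl: "x \<in> R \<Longrightarrow> cong_mod S x x"
  by (simp add: cong_mod_def ideal_generated_zero)

lemma cong_mod_add:
  assumes "cong_mod S x y" "cong_mod S u v"
  shows "cong_mod S (x + u) (y + v)"
proof -
  have "x + u - (y + v) = (x - y) + (u - v)"
    by simp
  with assms show ?thesis
    unfolding cong_mod_def by (metis add ideal_generated_add)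
qed

text \<open>The difference of the products is a combination of \<open>x - y\<close> and
  \<open>u - v\<close> with coefficients \<open>u\<close> and \<open>y\<close>. This is why a
  congruence also records that both sides lie in \<open>R\<close>.\<close>

lemma cong_mod_mult:
  assumes "cong_mod S x y" "cong_mod S u v"
  shows "cong_mod S (x * u) (y * v)"
proof -
  have "x * u - y * v = u * (x - y) + y * (u - v)"
    by (simp add: algebra_simps)
  moreover have "u * (x - y) + y * (u - v) \<in> ideal_generated R S"
    using assms unfolding cong_mod_def by (intro ideal_generated_add ideal_generated_mult) auto
  ultimately show ?thesis
    using assms unfolding cong_mod_def by (simp add: mult)
qed

lemma cong_mod_power: "cong_mod S x y \<Longrightarrow> cong_mod S (x ^ k) (y ^ k)"
  by (induction k) (auto intro: cong_mod_refl one cong_mod_mult)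

lemma cong_mod_prod:
  "(\<And>i. i \<in> A \<Longrightarrow> cong_mod S (f i) (g i)) \<Longrightarrow> cong_mod S (prod f A) (prod g A)"
  by (induction A rule: infinite_finite_induct) (auto intro: cong_mod_refl one cong_mod_mult)

lemma cong_mod_sum:
  "(\<And>i. i \<in> A \<Longrightarrow> cong_mod S (f i) (g i)) \<Longrightarrow> cong_mod S (sum f A) (sum g A)"
  by (induction A rule: infinite_finite_induct) (auto intro: cong_mod_refl zero cong_mod_add)

end


section \<open>Elimination in a dynamical system\<close>

locale dynamical_system =
  fixes N :: nat and Q b :: "(nat, 'k::field poly fract) mpoly"
    and a :: "nat \<Rightarrow> (nat, 'k poly fract) mpoly"
  assumes vars_Q: "vars Q \<subseteq> {1..N}"
    and vars_a: "i \<in> {1..N} \<Longrightarrow> vars (a i) \<subseteq> {1..N}"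
    and vars_b: "vars b \<subseteq> {1..N}"
begin

abbreviation q :: "'k sys_dpoly" where "q \<equiv> sys_of_u Q"

text \<open>Only the underived state variables: polynomials in these \<open>N\<close> variables are
  what everything is reduced to, up to powers of \<open>q\<close>.\<close>

definition states :: "sysvar set" where "states = (\<lambda>i. Ud i 0) ` {1..N}"

definition gens :: "'k sys_dpoly set" where
  "gens = {(sys_deriv ^^ k) g | k g. g \<in> sys_gens N Q a b}"

sublocale sys: derivation "sys_deriv :: 'k sys_dpoly \<Rightarrow> _"
  unfolding sys_deriv_def by (rule derivation.derivation_dpoly_deriv[OF derivation_dx])

sublocale ring: subring "sys_ring N :: 'k sys_dpoly set"
proof
  fix x y :: "'k sys_dpoly"
  assume x: "x \<in> sys_ring N"
  show "- x \<in> sys_ring N"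
    using x order_trans[OF vars_diff[of 0 x]] by (simp add: sys_ring_def)
  assume y: "y \<in> sys_ring N"
  show "x + y \<in> sys_ring N"
    using x y unfolding sys_ring_def mem_Collect_eq by (rule vars_add_subset)
  show "x * y \<in> sys_ring N"
    using x y unfolding sys_ring_def mem_Collect_eq by (rule vars_mult_subset)
qed (simp add: sys_ring_def)

abbreviation cong (infix "\<approx>" 50) where "x \<approx> y \<equiv> ring.cong_mod gens x y"

lemma states_subset_ring: "vars P \<subseteq> states \<Longrightarrow> P \<in> sys_ring N"
  by (force simp: states_def sys_ring_def)

lemma vars_sys_of_u: "vars P \<subseteq> {1..N} \<Longrightarrow> vars (sys_of_u P :: 'k sys_dpoly) \<subseteq> states"
  unfolding sys_of_u_def states_def
  by (rule order_trans[OF vars_mpoly_eval_mconst]) auto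

lemmas vars_q = vars_sys_of_u[OF vars_Q]

lemma sys_deriv_ring:
  fixes P :: "'k sys_dpoly"
  shows "P \<in> sys_ring N \<Longrightarrow> sys_deriv P \<in> sys_ring N"
  unfolding sys_ring_def sys_deriv_def mem_Collect_eq
  by (rule derivation.vars_dpoly_deriv[OF derivation_dx]) auto

text \<open>The generators include all derivatives of the system equations, so \<open>gens\<close>
  is closed under \<open>sys_deriv\<close>.\<close>

lemma sys_deriv_ideal:
  "x \<in> ideal_generated (sys_ring N) gens \<Longrightarrow> sys_deriv x \<in> ideal_generated (sys_ring N) gens"
proof (rule ring.ideal_generated_derivation[OF sys.derivation_axioms sys_deriv_ring])
  fix s assume "s \<in> gens"
  then obtain k g where "s = (sys_deriv ^^ k) g" "g \<in> sys_gens N Q a b"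
    unfolding gens_def by blast
  then have "sys_deriv s = (sys_deriv ^^ Suc k) g" "g \<in> sys_gens N Q a b"
    by simp_all
  then show "sys_deriv s \<in> gens"
    unfolding gens_def by blast
qed

lemma gens_base:
  assumes "g \<in> sys_gens N Q a b"
  shows "g \<in> ideal_generated (sys_ring N) gens"
proof -
  have "(sys_deriv ^^ 0) g \<in> gens"
    using assms unfolding gens_def by blast
  then show ?thesis
    by (simp add: ring.ideal_generated_base)
qed

section \<open>Reduction of derivatives to polynomials in the states\<close>

lemma gens_cong:
  assumes "q * mvar v - f \<in> sys_gens N Q a b" "mvar v \<in> (sys_ring N :: 'k sys_dpoly set)"
    and "vars f \<subseteq> states"
  shows "q * mvar v \<approx> f"
  unfolding ring.cong_mod_def
  by (intro conjI ring.mult states_subset_ring vars_q assms gens_base)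

text \<open>The derivative of \<open>f\<close> is of degree at most one in the derivatives of the
  states, and each of these becomes some \<open>a i\<close> after multiplication by
  \<open>q\<close>. Hence a single factor \<open>q\<close> suffices, whatever the degree of
  \<open>f\<close>.\<close>

lemma state_derivative:
  fixes f :: "'k sys_dpoly"
  assumes "vars f \<subseteq> states"
  shows "\<exists>g. vars g \<subseteq> states \<and> q * sys_deriv f \<approx> g"
  using assms
proof (induction rule: mpoly_induct_on)
  case (const c)
  have "vars (q * mconst (dx c)) \<subseteq> states"
    by (intro vars_mult_subset vars_q) simp
  then show ?case
    unfolding sys_deriv_def derivation.dpoly_deriv_mconst[OF derivation_dx]
    using ring.cong_mod_refl states_subset_ring by blast
next
  case (var v)
  then obtain i where i: "v = Ud i 0" "i \<in> {1..N}"
    by (auto simp: states_def)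
  have a: "vars (sys_of_u (a i) :: 'k sys_dpoly) \<subseteq> states"
    using vars_sys_of_u[OF vars_a] i(2) .
  have "q * mvar (Ud i 1) \<approx> sys_of_u (a i)"
    using i(2) by (intro gens_cong a) (auto simp: sys_gens_def sys_ring_def)
  then show ?case
    using a i(1) by (auto simp: sys_deriv_def derivation.dpoly_deriv_mvar[OF derivation_dx])
next
  case (add P R)
  then obtain g h where "vars g \<subseteq> states" "q * sys_deriv P \<approx> g"
    "vars h \<subseteq> states" "q * sys_deriv R \<approx> h"
    by blast
  then have "vars (g + h) \<subseteq> states \<and> q * sys_deriv (P + R) \<approx> g + h"
    unfolding sys.add ring_distribs by (intro conjI vars_add_subset ring.cong_mod_add)
  then show ?case
    by blast
next
  case (mult P R)
  then obtain g h where gh: "vars g \<subseteq> states" "q * sys_deriv P \<approx> g"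
    "vars h \<subseteq> states" "q * sys_deriv R \<approx> h"
    by blast
  have "(q * sys_deriv P) * R + P * (q * sys_deriv R) \<approx> g * R + P * h"
    using mult.hyps gh
    by (intro ring.cong_mod_add ring.cong_mod_mult ring.cong_mod_refl states_subset_ring)
  moreover have "(q * sys_deriv P) * R + P * (q * sys_deriv R) = q * sys_deriv (P * R)"
    by (simp add: sys.leibniz algebra_simps)
  moreover have "vars (g * R + P * h) \<subseteq> states"
    using mult.hyps gh by (intro vars_add_subset vars_mult_subset)
  ultimately show ?case
    by metis
qed

text \<open>The output equation starts the induction with exponent 1. Differentiating the relation
  for index \<open>j\<close> yields the one for \<open>Suc j\<close>, with the exponent growing from
  \<open>e\<close> to \<open>2 * e + 1\<close>.\<close>

lemma output_derivative:
  "\<exists>e c. vars c \<subseteq> states \<and> q ^ e * mvar (Od j) \<approx> c"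
proof (induction j)
  case 0
  have "q ^ 1 * mvar (Od 0) \<approx> sys_of_u b"
    unfolding power_one_right
    by (intro gens_cong vars_sys_of_u vars_b) (auto simp: sys_gens_def sys_ring_def)
  then show ?case
    using vars_sys_of_u[OF vars_b] by blast
next
  case (Suc j)
  then obtain e c where c: "vars c \<subseteq> states" "q ^ e * mvar (Od j) \<approx> c"
    by blast
  have vars_q_power: "vars (q ^ i) \<subseteq> states" for i
    by (rule order_trans[OF vars_power vars_q])
  from state_derivative[OF this] obtain h
    where h: "vars h \<subseteq> states" "q * sys_deriv (q ^ e) \<approx> h"
    by blast
  from state_derivative[OF c(1)] obtain k
    where k: "vars k \<subseteq> states" "q * sys_deriv c \<approx> k"
    by blast
  have q: "q ^ i \<in> sys_ring N" for i
    by (rule states_subset_ring[OF vars_q_power])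
  have W: "(mvar (Od j) :: 'k sys_dpoly) \<in> sys_ring N" for j
    by (simp add: sys_ring_def)
  define x where "x = q ^ e * mvar (Od j) - c"
  have Dx: "sys_deriv x = sys_deriv (q ^ e) * mvar (Od j) + q ^ e * mvar (Od (Suc j)) - sys_deriv c"
    unfolding x_def sys.diff sys.leibniz
    by (simp add: sys_deriv_def derivation.dpoly_deriv_mvar[OF derivation_dx])
  have "sys_deriv x \<in> ideal_generated (sys_ring N) gens"
    using c(2) sys_deriv_ideal unfolding x_def ring.cong_mod_def by blast
  moreover have "sys_deriv x \<in> sys_ring N"
    using sys_deriv_ring ring.add[OF ring.mult[OF q W] ring.uminus[OF states_subset_ring[OF c(1)]]]
    unfolding x_def by simp
  ultimately have "sys_deriv x \<approx> 0"
    by (simp add: ring.cong_mod_def ring.zero)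
  moreover have "- (q * sys_deriv (q ^ e)) \<approx> - 1 * h"
    using ring.cong_mod_mult[OF ring.cong_mod_refl[OF ring.uminus[OF ring.one]] h(2)] by simp
  \<comment> \<open>The two added terms cancel the derivatives of \<open>c\<close> and of
    \<open>q ^ e\<close> in \<open>sys_deriv x\<close>. The factor \<open>q ^ Suc e\<close> supplies
    one \<open>q\<close> to reduce each of these derivatives and \<open>q ^ e\<close> to replace
    \<open>mvar (Od j)\<close> by \<open>c\<close>.\<close>
  ultimately have "q ^ Suc e * sys_deriv x + q ^ e * (q * sys_deriv c)
        + (- (q * sys_deriv (q ^ e))) * (q ^ e * mvar (Od j))
      \<approx> q ^ Suc e * 0 + q ^ e * k + (- 1 * h) * c"
    using c(2) k(2) by (intro ring.cong_mod_add ring.cong_mod_mult[OF ring.cong_mod_refl[OF q]])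
      (assumption | rule ring.cong_mod_mult)+
  moreover have "q ^ Suc e * sys_deriv x + q ^ e * (q * sys_deriv c)
        + (- (q * sys_deriv (q ^ e))) * (q ^ e * mvar (Od j))
      = q ^ (Suc e + e) * mvar (Od (Suc j))"
    unfolding Dx power_add by (simp add: algebra_simps)
  moreover have "vars (q ^ Suc e * 0 + q ^ e * k + (- 1 * h) * c) \<subseteq> states"
    using vars_diff[of 0 "1 :: 'k sys_dpoly"] c(1) h(1) k(1)
    by (intro vars_add_subset vars_mult_subset vars_q_power) auto
  ultimately show ?case
    by metis
qed

text \<open>A variable is required to occur in \<open>P\<close>, because a non-zero constant would
  have no order.\<close>

lemma ex_derived_dpoly:
  "\<exists>P K. vars P \<noteq> {} \<and> vars P \<subseteq> Od ` {..N} \<and> q ^ K * P \<in> ideal_generated (sys_ring N) gens"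
proof -
  obtain e c where c: "\<And>j. vars (c j) \<subseteq> states" "\<And>j. q ^ e j * mvar (Od j) \<approx> c j"
    using output_derivative by metis
  obtain k0 where k0: "q \<in> box_polys states k0"
    using ex_box_polys[OF vars_q] by blast
  have "\<forall>j. \<exists>k. c j \<in> box_polys states k"
    using ex_box_polys[OF c(1)] by blast
  then obtain k where k: "\<And>j. c j \<in> box_polys states (k j)"
    by metis
  \<comment> \<open>One exponent bound for \<open>q\<close> and all \<open>c j\<close>; a sum serves
    as well as a maximum.\<close>
  define l where "l = k0 + (\<Sum>j\<le>N. k j)"
  have q_box: "q \<in> box_polys states l"
    using box_polys_mono[of k0 l] k0 by (auto simp: l_def)
  have c_box: "c j \<in> box_polys states l" if "j \<le> N" for j
    using box_polys_mono[of "k j" l] k[of j] member_le_sum[of j "{..N}" k] that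
    by (auto simp: l_def)
  \<comment> \<open>For index \<open>j\<close>, the product \<open>g t\<close> below has at most
    \<open>e j * d\<close> factors \<open>q\<close> and \<open>d\<close> factors \<open>c j\<close>,
    all with exponents at most \<open>l\<close>. This adds up to \<open>d * C\<close>.\<close>
  define C where "C = (\<Sum>j\<le>N. (e j + 1) * l)"
  \<comment> \<open>With \<open>d = M + 1\<close>, the number of monomials in the output is
    \<open>(M + 2) * Suc d ^ N\<close>, to be compared with at most \<open>M * Suc d ^ N\<close> in
    the states. The choice \<open>d = M\<close> would fail for \<open>N = 0\<close>, where dropping
    the monomial 1 uses up the margin.\<close>
  define M where "M = (C + 1) ^ N"
  define d where "d = M + 1"
  let ?W = "Od ` {..N}"
  \<comment> \<open>Without the monomial \<open>1\<close>, a non-trivial linear combination cannot be a constant.\<close>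
  define I where "I = exponent_box ?W d - {0}"
  define x where "x t j = Poly_Mapping.lookup t (Od j)" for t :: "sysvar \<Rightarrow>\<^sub>0 nat" and j
  define g where "g t = (\<Prod>j\<le>N. q ^ (e j * (d - x t j)) * c j ^ x t j)" for t
  define K where "K = (\<Sum>j\<le>N. e j * d)"
  have x_le: "x t j \<le> d" if "t \<in> I" for t j
    using that by (simp add: I_def exponent_box_def x_def)

  have g_box: "g t \<in> box_polys states (d * C)" if t: "t \<in> I" for t
  proof -
    have "q ^ (e j * (d - x t j)) * c j ^ x t j \<in> box_polys states (d * ((e j + 1) * l))"
      if "j \<le> N" for j
    proof -
      have "e j * (d - x t j) + x t j \<le> e j * d + d"
        using x_le[OF t, of j] by (intro add_mono mult_left_mono) auto
      then have "(e j * (d - x t j) + x t j) * l \<le> (e j * d + d) * l"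
        by (rule mult_right_mono) simp
      then have "e j * (d - x t j) * l + x t j * l \<le> d * ((e j + 1) * l)"
        by (simp add: algebra_simps)
      then show ?thesis
        using box_polys_mult[OF box_polys_power[OF q_box] box_polys_power[OF c_box[OF that]]]
          box_polys_mono by blast
    qed
    then have "g t \<in> box_polys states (\<Sum>j\<le>N. d * ((e j + 1) * l))"
      unfolding g_def by (intro box_polys_prod) simp
    then show ?thesis
      by (simp add: C_def sum_distrib_left)
  qed

  have "card states = N"
    by (simp add: states_def card_image inj_on_def)
  moreover have "card ?W = Suc N"
    by (simp add: card_image inj_on_def)
  moreover have "finite states" "finite ?W"
    by (simp_all add: states_def)
  ultimately have box_cards: "card (exponent_box states (d * C)) = Suc (d * C) ^ N"
    "finite (exponent_box states (d * C))"
    "card (exponent_box ?W d) = Suc d ^ Suc N" "finite (exponent_box ?W d)"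
    by (simp_all add: exponent_box_card)
  have "0 \<in> exponent_box ?W d"
    by (simp add: exponent_box_def)
  then have card_I: "card I = Suc d ^ Suc N - 1" and "finite I"
    using box_cards(3,4) by (simp_all add: I_def)
  \<comment> \<open>The factor \<open>(C + 1) ^ N\<close> is independent of \<open>d\<close>,
    whereas \<open>card I\<close> has one more factor \<open>Suc d\<close>.\<close>
  have "Suc (d * C) ^ N \<le> ((C + 1) * Suc d) ^ N"
    by (intro power_mono) (simp_all add: algebra_simps)
  also have "\<dots> = M * Suc d ^ N"
    unfolding M_def by (rule power_mult_distrib)
  also have "\<dots> < M * Suc d ^ N + 2 * Suc d ^ N - 1"
  proof -
    have "Suc d ^ N > 0"
      by simp
    then show ?thesis
      by linarith
  qed
  also have "\<dots> = card I"
    unfolding card_I d_def by (simp add: algebra_simps)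
  finally have card_less: "card (exponent_box states (d * C)) < card I"
    by (simp add: box_cards(1))
  obtain \<alpha> where \<alpha>: "\<exists>t\<in>I. \<alpha> t \<noteq> 0" "(\<Sum>t\<in>I. mconst (\<alpha> t) * g t) = 0"
    using linearly_dependent_mpolys[OF \<open>finite I\<close> box_cards(2) card_less, of g] g_box
    unfolding box_polys_def by blast

  \<comment> \<open>The coefficients of the relation among the \<open>g t\<close> are transferred to
    the monomials \<open>t\<close> themselves. These are distinct, so no coefficients merge.\<close>
  define P where "P = (\<Sum>t\<in>I. Poly_Mapping.single t (\<alpha> t))"
  have lookup_P: "Poly_Mapping.lookup P t = (if t \<in> I then \<alpha> t else 0)" for t
    using \<open>finite I\<close> by (simp add: P_def lookup_sum lookup_single when_def)
  have "vars P \<subseteq> ?W"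
    by (auto simp: vars_def lookup_P in_keys_iff[of _ P] I_def exponent_box_def split: if_splits)
  moreover have "vars P \<noteq> {}"
  proof -
    from \<alpha>(1) obtain t where "t \<in> I" "\<alpha> t \<noteq> 0"
      by blast
    then have "t \<in> Poly_Mapping.keys P" "Poly_Mapping.keys t \<noteq> {}"
      by (simp_all add: in_keys_iff lookup_P I_def)
    then show ?thesis
      by (auto simp: vars_def)
  qed
  moreover have "q ^ K * P \<approx> 0"
  proof -
    have "q ^ K * Poly_Mapping.single t 1 \<approx> g t" if t: "t \<in> I" for t
    proof -
      have "Poly_Mapping.single t 1 = (\<Prod>v\<in>?W. mvar v ^ Poly_Mapping.lookup t v :: 'k sys_dpoly)"
        using t by (intro single_eq_prod_mvar) (auto simp: I_def exponent_box_def)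
      also have "\<dots> = (\<Prod>j\<le>N. mvar (Od j) ^ x t j)"
        by (simp add: prod.reindex inj_on_def x_def)
      finally have "q ^ K * Poly_Mapping.single t 1
          = (\<Prod>j\<le>N. q ^ (e j * d) * mvar (Od j) ^ x t j)"
        by (simp add: K_def power_sum prod.distrib)
      also have "\<dots> = (\<Prod>j\<le>N. q ^ (e j * (d - x t j)) * (q ^ e j * mvar (Od j)) ^ x t j)"
      proof (rule prod.cong)
        fix j
        \<comment> \<open>The subtraction is exact because exponents in the box are at most
          \<open>d\<close>.\<close>
        have "e j * d = e j * (d - x t j) + e j * x t j"
          using x_le[OF t, of j] by (simp flip: distrib_left)
        then show "q ^ (e j * d) * mvar (Od j) ^ x t j
            = q ^ (e j * (d - x t j)) * (q ^ e j * mvar (Od j)) ^ x t j"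
          by (simp add: power_add power_mult power_mult_distrib mult.assoc)
      qed simp
      also have "\<dots> \<approx> g t"
        unfolding g_def
        by (intro ring.cong_mod_prod ring.cong_mod_mult ring.cong_mod_power c(2)
            ring.cong_mod_refl ring.power states_subset_ring vars_q)
      finally show ?thesis .
    qed
    then have "(\<Sum>t\<in>I. mconst (\<alpha> t) * (q ^ K * Poly_Mapping.single t 1))
        \<approx> (\<Sum>t\<in>I. mconst (\<alpha> t) * g t)"
      by (intro ring.cong_mod_sum ring.cong_mod_mult ring.cong_mod_refl states_subset_ring) simp_all
    moreover have "(\<Sum>t\<in>I. mconst (\<alpha> t) * (q ^ K * Poly_Mapping.single t 1)) = q ^ K * P"
      unfolding P_def sum_distrib_left
      by (intro sum.cong refl) (subst (2) single_eq_mconst_mult, simp add: mult_ac)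
    ultimately show ?thesis
      using \<alpha>(2) by simp
  qed
  ultimately show ?thesis
    unfolding ring.cong_mod_def by auto
qed

end

text \<open>Existence is part of the conclusion because \<open>LEAST\<close> says nothing about an
  empty set of orders. As \<open>Q\<close>, \<open>a\<close> and \<open>b\<close> are arbitrary, the
  bound holds for every choice of the common denominator.\<close>

theorem proposition4p12:
  fixes F :: "'k::field_char_0 poly fract set"
    and p q :: "'k poly fract dpoly1"
    and n m :: nat
    and Q b :: "(nat, 'k poly fract) mpoly"
    and a :: "nat \<Rightarrow> (nat, 'k poly fract) mpoly"
  assumes "F = range to_fract \<or> F = UNIV"
    and "p \<in> dpolys_over F" and "q \<in> dpolys_over F"
    and "lho p n" and "lho q m"
    and "denominators_nonzero n p m q"
    and "common_denominator (composition_model n p m q) Q a b"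
  shows "(\<exists>P\<in>derived_dpolys (m + n) Q a b. P \<noteq> 0 \<and> (\<exists>r. has_order Od P r))
    \<and> min_derived_order (m + n) Q a b \<le> m + n"
proof -
  \<comment> \<open>The composition model has \<open>m\<close> states for z and \<open>n\<close> for
    w, so the elimination applies with \<open>N = m + n\<close>.\<close>
  interpret sys: dynamical_system "m + n" Q b a
    using assms(7) by unfold_locales (auto simp: common_denominator_def composition_model_def)
  obtain P K where P: "vars P \<noteq> {}" "vars P \<subseteq> Od ` {..m + n}"
    "sys_of_u Q ^ K * P \<in> ideal_generated (sys_ring (m + n)) sys.gens"
    using sys.ex_derived_dpoly by blast
  from P(2) have "P \<in> sys_ring (m + n)"
    by (auto simp: sys_ring_def)
  then have derived: "P \<in> derived_dpolys (m + n) Q a b"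
    using P(2,3)
    by (auto simp: derived_dpolys_def model_ideal_def saturation_def sys.gens_def)
  \<comment> \<open>The largest index in \<open>J\<close> is the order of \<open>P\<close>; it
    exists because \<open>P\<close> is not constant.\<close>
  define J where "J = {j. Od j \<in> vars P}"
  have "J \<subseteq> {..m + n}" "J \<noteq> {}"
    using P(1,2) by (auto simp: J_def)
  then have "finite J" "Max J \<in> J" "Max J \<le> m + n"
    using finite_subset[of J "{..m + n}"] Max_in[of J] by auto
  then have order: "has_order Od P (Max J)"
    by (auto simp: has_order_def J_def intro: Max_ge)
  have "P \<noteq> 0"
    using P(1) by auto
  with derived order have "Max J \<in> derived_orders (m + n) Q a b"
    by (auto simp: derived_orders_def)
  then have "min_derived_order (m + n) Q a b \<le> Max J"
    unfolding min_derived_order_def by (rule Least_le)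
  with \<open>Max J \<le> m + n\<close> \<open>P \<noteq> 0\<close> derived order show ?thesis
    by force
qed

end
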